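(* Let $(\mathcal{X},d,\mu)$ be a space of homogeneous type and $\theta\in(0,1)$. Then the constant function $1$ belongs to $\mathrm{lip}_\theta(\mathcal{X})$ if and only if there exists a positive constant $C$ such that, for any $x\in\mathcal{X}$, $\mu(B(x,1))\ge C$.
   Context: **Space of homogeneous type.** $\mathcal{X}$ is a non-empty set, $d:\mathcal{X}\times\mathcal{X}\to[0,\infty)$ satisfies $d(x,y)=0\iff x=y$, $d(x,y)=d(y,x)$, and $d(x,z)\le A_0[d(x,y)+d(y,z)]$ for a constant $A_0\in[1,\infty)$; $\mu$ is a measure on $\mathcal{X}$ such that $\mu(2B)\le C\mu(B)$ for all balls $B=B(x_B,r_B):=\{x:d(x_B,x)<r_B\}$, where $\tau B:=B(x_B,\tau r_B)$. Standing assumptions: $\mu(\mathcal{X})=\infty$; for each $x$ the balls $\{B(x,r)\}_{r>0}$ form a basis of open neighborhoods of $x$; $\mu$ is Borel regular (open sets are measurable and every set $A$ lies in a Borel set $E$ with $\mu(A)=\mu(E)$); $\mu(B(x,r))\in(0,\infty)$ and $\mu(\{x\})=0$ for all $x$ and $r>0$. **Inhomogeneous Lipschitz space.** $L^q_{\mathcal{B}}(\mathcal{X})$ ($q\in[1,\infty]$) is the set of measurable $f$ with $f\mathbf{1}_B\in L^q(\mathcal{X})$ for every ball $B$. For $\theta\in(0,1)$ and a ball $B$ of radius $r_B$, let $\mathcal{M}^B_\theta(f):=\sup_{x,y\in B}|f(x)-f(y)|/[\mu(B)]^\theta$ if $r_B\in(0,1]$ and $\mathcal{M}^B_\theta(f):=\|f\|_{L^\infty(B)}/[\mu(B)]^\theta$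 if $r_B\in(1,\infty)$. Then $\mathrm{lip}_\theta(\mathcal{X}):=\{f\in L^q_{\mathcal{B}}(\mathcal{X}):\|f\|_{\mathrm{lip}_\theta(\mathcal{X})}:=\sup_B\mathcal{M}^B_\theta(f)<\infty\}$, the supremum being over all balls (the choice of $q$ is immaterial). *)

theory Defs
  imports "HOL-Probability.Essential_Supremum"
begin

definition qball :: "'a set \<Rightarrow> ('a \<Rightarrow> 'a \<Rightarrow> real) \<Rightarrow> 'a \<Rightarrow> real \<Rightarrow> 'a set"
  where "qball X d x r = {y \<in> X. d x y < r}"

text \<open>The topology induced by a quasi-metric. In general the balls of a quasi-metric are
  neighborhoods of their centers but need not be open.\<close>

definition qtopology :: "'a set \<Rightarrow> ('a \<Rightarrow> 'a \<Rightarrow> real) \<Rightarrow> 'a topology"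
  where "qtopology X d =
    topology (\<lambda>U. U \<subseteq> X \<and> (\<forall>x\<in>U. \<exists>r>0. qball X d x r \<subseteq> U))"

lemma openin_qtopology:
  "openin (qtopology X d) U \<longleftrightarrow> U \<subseteq> X \<and> (\<forall>x\<in>U. \<exists>r>0. qball X d x r \<subseteq> U)"
proof -
  let ?P = "\<lambda>U. U \<subseteq> X \<and> (\<forall>x\<in>U. \<exists>r>0. qball X d x r \<subseteq> U)"
  have "?P (S \<inter> T)" if S: "?P S" and T: "?P T" for S T
  proof (intro conjI ballI)
    show "S \<inter> T \<subseteq> X" using S by blast
    fix x assume "x \<in> S \<inter> T"
    then obtain r s where rs: "r > 0" "qball X d x r \<subseteq> S" "s > 0" "qball X d x s \<subseteq> T"
      using S T by blast
    have "qball X d x (min r s) \<subseteq> S \<inter> T"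
      using rs(2,4) by (auto simp: qball_def)
    then show "\<exists>t>0. qball X d x t \<subseteq> S \<inter> T"
      using rs(1,3) by (intro exI[of _ "min r s"]) auto
  qed
  moreover have "?P (\<Union>K)" if "\<forall>U\<in>K. ?P U" for K
  proof (intro conjI ballI)
    show "\<Union>K \<subseteq> X" using that by blast
    fix x assume "x \<in> \<Union>K"
    then obtain U where "U \<in> K" "x \<in> U" by blast
    with that obtain r where "r > 0" "qball X d x r \<subseteq> U" by blast
    with \<open>U \<in> K\<close> show "\<exists>r>0. qball X d x r \<subseteq> \<Union>K" by blast
  qed
  ultimately have "istopology ?P"
    unfolding istopology_def by blast
  then show ?thesis
    by (simp add: qtopology_def topology_inverse')
qed

text \<open>The underlying set is \<open>space M\<close>. Borel regularity speaks about arbitrary, possibly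
  non-measurable, sets, hence the outer measure.\<close>

locale homogeneous_type_space =
  fixes M :: "'a measure" and d :: "'a \<Rightarrow> 'a \<Rightarrow> real"
  assumes nonempty: "space M \<noteq> {}"
    and d_nonneg: "\<And>x y. x \<in> space M \<Longrightarrow> y \<in> space M \<Longrightarrow> 0 \<le> d x y"
    and d_eq_0_iff: "\<And>x y. x \<in> space M \<Longrightarrow> y \<in> space M \<Longrightarrow> d x y = 0 \<longleftrightarrow> x = y"
    and d_commute: "\<And>x y. x \<in> space M \<Longrightarrow> y \<in> space M \<Longrightarrow> d x y = d y x"
    and quasi_triangle: "\<exists>A\<^sub>0\<ge>1. \<forall>x\<in>space M. \<forall>y\<in>space M. \<forall>z\<in>space M.
          d x z \<le> A\<^sub>0 * (d x y + d y z)"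
    and doubling: "\<exists>C>0. \<forall>x\<in>space M. \<forall>r>0.
          emeasure M (qball (space M) d x (2 * r)) \<le> ennreal C * emeasure M (qball (space M) d x r)"
    and measure_space_infinite: "emeasure M (space M) = \<infinity>"
    and balls_open: "\<And>x r. x \<in> space M \<Longrightarrow> 0 < r \<Longrightarrow>
          openin (qtopology (space M) d) (qball (space M) d x r)"
    and balls_basis: "\<And>x U. openin (qtopology (space M) d) U \<Longrightarrow> x \<in> U \<Longrightarrow>
          \<exists>r>0. qball (space M) d x r \<subseteq> U"
    and open_measurable: "\<And>U. openin (qtopology (space M) d) U \<Longrightarrow> U \<in> sets M"
    and borel_regular: "\<And>A. A \<subseteq> space M \<Longrightarrow>
          \<exists>E \<in> sigma_sets (space M) {U. openin (qtopology (space M) d) U}.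
            A \<subseteq> E \<and> outer_measure_of M A = emeasure M E"
    and ball_measure: "\<And>x r. x \<in> space M \<Longrightarrow> 0 < r \<Longrightarrow>
          0 < emeasure M (qball (space M) d x r) \<and> emeasure M (qball (space M) d x r) < \<infinity>"
    and point_measure: "\<And>x. x \<in> space M \<Longrightarrow> emeasure M {x} = 0"

text \<open>Functions take values in \<open>'b :: real_normed_field\<close>, so that real- and complex-valued
  functions are both covered. Their values outside \<open>space M\<close> play no role.\<close>

definition Linf_norm :: "'a measure \<Rightarrow> ('a \<Rightarrow> 'b::{real_normed_field, second_countable_topology}) \<Rightarrow> ennreal"
  where "Linf_norm M f = esssup M (\<lambda>x. ennreal (norm (f x)))"

definition Lq :: "'a measure \<Rightarrow> ennreal \<Rightarrow> ('a \<Rightarrow> 'b::{real_normed_field, second_countable_topology}) set"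
  where "Lq M q = {f \<in> borel_measurable M.
    if q = \<infinity> then Linf_norm M f < \<infinity>
    else (\<integral>\<^sup>+x. ennreal (norm (f x) powr enn2real q) \<partial>M) < \<infinity>}"

definition Lq_on_balls ::
  "'a measure \<Rightarrow> ('a \<Rightarrow> 'a \<Rightarrow> real) \<Rightarrow> ennreal \<Rightarrow> ('a \<Rightarrow> 'b::{real_normed_field, second_countable_topology}) set"
  where "Lq_on_balls M d q = {f \<in> borel_measurable M. \<forall>x\<in>space M. \<forall>r>0.
    (\<lambda>y. f y * indicator (qball (space M) d x r) y) \<in> Lq M q}"

text \<open>A ball is given by its center and radius, as the same set may be a ball with several radii.
  The local quantity for the ball with center \<open>x\<close> and radius \<open>r\<close>:\<close>

definition lip_local ::
  "'a measure \<Rightarrow> ('a \<Rightarrow> 'a \<Rightarrow> real) \<Rightarrow> real \<Rightarrow> ('a \<Rightarrow> 'b::{real_normed_field, second_countable_topology}) \<Rightarrow> 'a \<Rightarrow> real \<Rightarrow> ennreal"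
  where "lip_local M d \<theta> f x r = (let B = qball (space M) d x r in
    (if r \<le> 1 then (SUP (y, z) \<in> B \<times> B. ennreal (norm (f y - f z)))
     else Linf_norm (restrict_space M B) f) / ennreal (measure M B powr \<theta>))"

definition lip_norm ::
  "'a measure \<Rightarrow> ('a \<Rightarrow> 'a \<Rightarrow> real) \<Rightarrow> real \<Rightarrow> ('a \<Rightarrow> 'b::{real_normed_field, second_countable_topology}) \<Rightarrow> ennreal"
  where "lip_norm M d \<theta> f = (SUP (x, r) \<in> space M \<times> {0<..}. lip_local M d \<theta> f x r)"

definition lip_space ::
  "'a measure \<Rightarrow> ('a \<Rightarrow> 'a \<Rightarrow> real) \<Rightarrow> ennreal \<Rightarrow> real \<Rightarrow> ('a \<Rightarrow> 'b::{real_normed_field, second_countable_topology}) set"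
  where "lip_space M d q \<theta> = {f \<in> Lq_on_balls M d q. lip_norm M d \<theta> f < \<infinity>}"

end

theory Submission
  imports Defs
begin

text \<open>The constant function 1 has zero oscillation, so balls of radius at most 1 contribute
  nothing to its norm. On a ball B of radius greater than 1 its essential supremum is 1, and the
  contribution is the inverse of mu(B)^\<theta> (\<open>lip_local_one\<close>). Local integrability
  is automatic because balls have finite measure (\<open>one_in_Lq_on_balls\<close>). Membership
  thus means that the measures of all balls of radius greater than 1 have a common positive lower
  bound. Monotonicity of the measure derives this from a bound at radius 1; conversely, doubling
  carries a bound at radius 2 down to radius 1.\<close>

context homogeneous_type_space
begin

lemma qball_sets: "x \<in> space M \<Longrightarrow> 0 < r \<Longrightarrow> qball (space M) d x r \<in> sets M"
  using balls_open open_measurable by blast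

lemma emeasure_qball_eq_measure:
  assumes "x \<in> space M" "0 < r"
  shows "emeasure M (qball (space M) d x r) = ennreal (measure M (qball (space M) d x r))"
  using ball_measure[OF assms] by (simp add: emeasure_eq_ennreal_measure less_top)

lemma measure_qball_pos:
  assumes "x \<in> space M" "0 < r"
  shows "0 < measure M (qball (space M) d x r)"
  using ball_measure[OF assms] emeasure_qball_eq_measure[OF assms] by simp

text \<open>The essential supremum of a constant is that constant only on a space of nonzero
  measure, so positivity of the measure of balls enters here.\<close>

lemma Linf_norm_one_qball:
  assumes "x \<in> space M" "0 < r"
  shows "Linf_norm (restrict_space M (qball (space M) d x r))
    (\<lambda>_. 1 :: 'b::{real_normed_field, second_countable_topology}) = 1"
proof -
  let ?B = "qball (space M) d x r"
  have "emeasure (restrict_space M ?B) (space (restrict_space M ?B)) = emeasure M ?B"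
    using qball_sets[OF assms]
    by (simp add: emeasure_restrict_space space_restrict_space sets.Int_space_eq1)
  then show ?thesis
    using ball_measure[OF assms] esssup_const[of "restrict_space M ?B" "1 :: ennreal"]
    by (auto simp: Linf_norm_def)
qed

lemma lip_local_one:
  assumes "x \<in> space M" "0 < r"
  shows "lip_local M d \<theta> (\<lambda>_. 1 :: 'b::{real_normed_field, second_countable_topology}) x r
    = (if r \<le> 1 then 0 else ennreal (1 / measure M (qball (space M) d x r) powr \<theta>))"
proof (cases "r \<le> 1")
  case True
  then show ?thesis
    \<comment> \<open>Writing 0 as \<open>bot\<close> lets the supremum of the constant 0 collapse;
      the second call turns \<open>bot\<close> back into 0.\<close>
    by (simp add: lip_local_def case_prod_unfold flip: bot_ennreal) (simp add: bot_ennreal)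
next
  case False
  then show ?thesis
    using measure_qball_pos[OF assms]
    by (simp add: lip_local_def Linf_norm_one_qball[OF assms] divide_ennreal flip: ennreal_1)
qed

lemma one_in_Lq_on_balls:
  "(\<lambda>_. 1 :: 'b::{real_normed_field, second_countable_topology}) \<in> Lq_on_balls M d q"
proof -
  have "(\<lambda>y. 1 * indicator (qball (space M) d x r) y :: 'b) \<in> Lq M q"
    if x: "x \<in> space M" and r: "0 < r" for x r
  proof -
    let ?B = "qball (space M) d x r"
    note [measurable] = qball_sets[OF x r]
    have "Linf_norm M (\<lambda>y. indicator ?B y :: 'b) \<le> 1"
      unfolding Linf_norm_def by (intro esssup_I) (auto simp: indicator_def)
    moreover have "(\<integral>\<^sup>+y. ennreal (norm (indicator ?B y :: 'b) powr p) \<partial>M) = emeasure M ?B" for p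
    proof -
      \<comment> \<open>This holds for every real p, since \<open>0 powr p = 0\<close> even at p =
        0.\<close>
      have "ennreal (norm (indicator ?B y :: 'b) powr p) = indicator ?B y" for y
        by (simp add: indicator_def)
      then show ?thesis by simp
    qed
    ultimately show ?thesis
      using ball_measure[OF x r] by (auto simp: Lq_def le_less_trans)
  qed
  then show ?thesis
    by (simp add: Lq_on_balls_def)
qed

end

theorem corollary4p1:
  fixes M :: "'a measure" and d :: "'a \<Rightarrow> 'a \<Rightarrow> real" and q :: ennreal and \<theta> :: real
  assumes "homogeneous_type_space M d"
    and "1 \<le> q" and "0 < \<theta>" and "\<theta> < 1"
  shows "(\<lambda>_. 1 :: 'b::{real_normed_field, second_countable_topology}) \<in> lip_space M d q \<theta>
    \<longleftrightarrow> (\<exists>C::real. C > 0 \<and> (\<forall>x\<in>space M. emeasure M (qball (space M) d x 1) \<ge> ennreal C))"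
proof -
  interpret homogeneous_type_space M d by fact
  let ?B = "qball (space M) d" and ?one = "\<lambda>_. 1 :: 'b"
  show ?thesis
  proof
    assume "?one \<in> lip_space M d q \<theta>"
    then obtain k where k: "lip_norm M d \<theta> ?one = ennreal k" "0 \<le> k"
      by (auto simp: lip_space_def elim: less_top_ennreal[THEN iffD1, elim_format])
    from doubling obtain D where D: "D > 0"
      "\<And>x r. x \<in> space M \<Longrightarrow> 0 < r \<Longrightarrow> emeasure M (?B x (2 * r)) \<le> ennreal D * emeasure M (?B x r)"
      by blast
    \<comment> \<open>Radius 1 falls in the oscillation case and gives no information. Radius 2 lies
      in the other case and is one doubling away from radius 1.\<close>
    have bound: "1 / measure M (?B x 2) powr \<theta> \<le> k" if x: "x \<in> space M" for x
    proof -
      have "lip_local M d \<theta> ?one x 2 \<le> lip_norm M d \<theta> ?one"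
        unfolding lip_norm_def using x by (intro SUP_upper2[of "(x, 2)"]) auto
      then show ?thesis
        using k x by (simp add: lip_local_one)
    qed
    have "k > 0"
    proof -
      obtain x where x: "x \<in> space M" using nonempty by blast
      have "0 < 1 / measure M (?B x 2) powr \<theta>" using measure_qball_pos[OF x, of 2] by simp
      with bound[OF x] show ?thesis by linarith
    qed
    \<comment> \<open>Solving 1 / m^\<theta> \<le> k for m gives m \<ge> c, a lower bound at radius
      2; the doubling constant D then costs a factor 1 / D at radius 1.\<close>
    define c where "c = (1 / k) powr (1 / \<theta>)"
    have "ennreal (c / D) \<le> emeasure M (?B x 1)" if x: "x \<in> space M" for x
    proof -
      let ?m = "measure M (?B x 2)"
      have m: "0 < ?m" using measure_qball_pos[OF x, of 2] by simp
      have "1 / k \<le> ?m powr \<theta>"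
        using bound[OF x] m \<open>k > 0\<close> by (simp add: field_simps)
      then have "c \<le> (?m powr \<theta>) powr (1 / \<theta>)"
        unfolding c_def using \<open>k > 0\<close> \<open>0 < \<theta>\<close> by (intro powr_mono2) auto
      also have "\<dots> = ?m" using m \<open>0 < \<theta>\<close> by (simp add: powr_powr)
      also have "\<dots> \<le> D * measure M (?B x 1)"
        using D(2)[OF x, of 1] \<open>D > 0\<close> x
        by (simp add: emeasure_qball_eq_measure flip: ennreal_mult)
      finally show ?thesis
        using \<open>D > 0\<close> x by (simp add: emeasure_qball_eq_measure field_simps)
    qed
    moreover have "0 < c / D" using \<open>k > 0\<close> \<open>D > 0\<close> by (simp add: c_def)
    ultimately show "\<exists>C::real. C > 0 \<and> (\<forall>x\<in>space M. emeasure M (?B x 1) \<ge> ennreal C)"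
      by blast
  next
    assume "\<exists>C::real. C > 0 \<and> (\<forall>x\<in>space M. emeasure M (?B x 1) \<ge> ennreal C)"
    then obtain C where C: "C > 0" "\<And>x. x \<in> space M \<Longrightarrow> ennreal C \<le> emeasure M (?B x 1)"
      by blast
    have "lip_local M d \<theta> ?one x r \<le> ennreal (1 / C powr \<theta>)" if x: "x \<in> space M" and r: "0 < r" for x r
    proof (cases "r \<le> 1")
      case False
      \<comment> \<open>For r > 1 the unit ball with the same center is contained in the ball of
        radius r.\<close>
      have "ennreal C \<le> emeasure M (?B x r)"
        using False by (intro order_trans[OF C(2)[OF x] emeasure_mono] qball_sets x r)
          (auto simp: qball_def)
      then have "C \<le> measure M (?B x r)"
        by (simp add: emeasure_qball_eq_measure x r)
      then have "C powr \<theta> \<le> measure M (?B x r) powr \<theta>"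
        using C(1) \<open>0 < \<theta>\<close> by (intro powr_mono2) auto
      then show ?thesis
        using False C(1) measure_qball_pos[OF x r]
        by (auto simp: lip_local_one x r intro!: ennreal_leI divide_left_mono)
    qed (simp add: lip_local_one x r)
    then have "lip_norm M d \<theta> ?one \<le> ennreal (1 / C powr \<theta>)"
      unfolding lip_norm_def by (intro SUP_least) auto
    then have "lip_norm M d \<theta> ?one < \<infinity>"
      by (auto intro: le_less_trans)
    then show "?one \<in> lip_space M d q \<theta>"
      using one_in_Lq_on_balls by (simp add: lip_space_def)
  qed
qed

end
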